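(* Consider the convex problem $(P_3)$ $$\min_{p,q,\hat v}\ \sum_{i\in\mathcal N} C_i(p_i,q_i)+\gamma D(\hat v)\quad\text{s.t.}\quad \hat v=Rp+Xq+a,\quad \underline v\le\hat v\le\overline v,\quad (p_i,q_i)\in\mathcal Z_i\ \ \forall i\in\mathcal N,$$ and the (usually non-convex) problem $(P_2)$ $$\min_{p,q,\hat v,\alpha,\beta}\ \sum_{i\in\mathcal N} C_i(p_i,q_i)+\gamma D(\hat v)\quad\text{s.t.}\quad \hat v=Rp+Xq+a,\quad \underline v\le\hat v\le\overline v,\quad (p_i,q_i)=b_i(\alpha_i,\beta_i)\ \ \forall i\in\mathcal N,$$ under the standing assumptions listed in the context. Let $(p^*,q^*,\hat v^* )$ be the optimal solution of $(P_3)$, let $\underline\mu^*,\overline\mu^*$ be optimal dual variables of $(P_3)$ associated with the constraints $\underline v\le\hat v$ and $\hat v\le\overline v$ respectively, and define the signals $$\alpha^*=R\big(\underline\mu^*-\overline\mu^*-\gamma\nabla_{\hat v}D(\hat v^* )\big),\qquad \beta^*=X\big(\underline\mu^*-\overline\mu^*-\gamma\nabla_{\hat v}D(\hat v^* )\big).$$ Then the solution of $(P_3)$ along with these signals, i.e. $(p^*,q^*,\hat v^*,\alpha^*,\beta^* )$, is a global optimal solution of $(P_2)$; that is, $(P_3)$ is an exact convex relaxation of $(P_2)$.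
   Context: Let $\mathcal N=\{1,\dots,N\}$, $p,q,\hat v,\alpha,\beta\in\mathbb R^N$, $\gamma\in\mathbb R_+$, $a,\underline v,\overline v\in\mathbb R^N$. The matrices $R,X\in\mathbb R_{++}^{N\times N}$ ($N\times N$ real matrices with positive entries) and the vector $a$ are the parameters of a linear approximation $\hat v=Rp+Xq+a$ of the voltage magnitudes as a function of the active and reactive power injections $p,q$. Vector inequalities are componentwise. Each $\mathcal Z_i\subset\mathbb R^2$ (feasible set of $(p_i,q_i)$) is convex and compact, and $\mathcal Z=\mathcal Z_1\times\dots\times\mathcal Z_N$. Best response: for $(\alpha_i,\beta_i)\in\mathbb R^2$, $b_i(\alpha_i,\beta_i)$ is the unique minimizer over $(p_i,q_i)\in\mathcal Z_i$ of $C_i(p_i,q_i)-\alpha_ip_i-\beta_iq_i$. Standing assumptions. (1) Each $C_i$ is continuously differentiable and strongly convex in $(p_i,q_i)$, with first-order derivative bounded on $\mathcal Z_i$. (2) $D$ is continuously differentiable and convex, with first-order derivative bounded at achievable voltage magnitude values. (3) (Slater's condition) There exists $(\tilde p,\tilde q)\in\mathcal Z$ with $\underline v\le R\tilde p+X\tilde q+a\le\overline v$. Under these assumptions $(P_3)$ has a unique optimal solution. The Lagrangian of $(P_3)$, with $\hat v=Rp+Xq+a$ substituted and the constraint $(p,q)\in\mathcal Z$ kept implicit, is $$\mathcal L(p,q,\underline\mu,\overline\mu)=\sum_{i\in\mathcal N}C_i(p_i,q_i)+\gamma D(Rp+Xq+a)+\underline\mu^\top(\underline v-Rp-Xq-a)+\overline\mu^\top(Rp+Xq+a-\overline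 v),$$ and $\underline\mu^*,\overline\mu^*\in\mathbb R_+^N$ are optimal dual variables if $(p^*,q^*,\underline\mu^*,\overline\mu^* )$ is a saddle point of $\mathcal L$ (minimized over $(p,q)\in\mathcal Z$, maximized over $\underline\mu,\overline\mu\in\mathbb R_+^N$). $\nabla_{\hat v}D$ denotes the gradient of $D$ with respect to $\hat v$.
   Formalization: The signals α*=R(…), β*=X(…) are optimal as written only for symmetric R and X (the claim fails for some non-symmetric positive R); for general R, X the result is proved with the transposes, α*=Rᵀ(…), β*=Xᵀ(…). *)

theory Defs
  imports "HOL-Analysis.Analysis"
begin

definition grad :: "('a::euclidean_space \<Rightarrow> real) \<Rightarrow> 'a \<Rightarrow> 'a" where
  "grad f x = (THE g. GDERIV f x :> g)"

(* Derivatives are taken in the ambient space (GDERIV uses the filter "at x"), so f is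
   differentiable at the points of S in the full sense, also at boundary points and when S
   has empty interior.  GDERIV f x :> grad f x says exactly that f is differentiable at x. *)
definition cont_diff_on :: "'a::euclidean_space set \<Rightarrow> ('a \<Rightarrow> real) \<Rightarrow> bool" where
  "cont_diff_on S f \<longleftrightarrow> (\<forall>x\<in>S. GDERIV f x :> grad f x) \<and> continuous_on S (grad f)"

definition strongly_convex_on :: "'a::euclidean_space set \<Rightarrow> ('a \<Rightarrow> real) \<Rightarrow> bool" where
  "strongly_convex_on S f \<longleftrightarrow> convex S \<and>
     (\<exists>m>0. \<forall>x\<in>S. \<forall>y\<in>S. \<forall>t\<in>{0..1}.
        f ((1 - t) *\<^sub>R x + t *\<^sub>R y)
          \<le> (1 - t) * f x + t * f y - m / 2 * t * (1 - t) * (norm (x - y))\<^sup>2)"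

(* The nodes 1, ..., N are the elements of the finite index type 'n. *)

definition injections :: "('n::finite \<Rightarrow> (real \<times> real) set) \<Rightarrow> ((real^'n) \<times> (real^'n)) set" where
  "injections Z = {(p, q). \<forall>i. (p $ i, q $ i) \<in> Z i}"

definition voltage ::
    "real^'n^'n \<Rightarrow> real^'n^'n \<Rightarrow> real^'n \<Rightarrow> real^'n \<Rightarrow> real^'n \<Rightarrow> real^'n::finite" where
  "voltage R X a p q = R *v p + X *v q + a"

definition achievable_voltages ::
    "real^'n^'n \<Rightarrow> real^'n^'n \<Rightarrow> real^'n \<Rightarrow> ('n::finite \<Rightarrow> (real \<times> real) set) \<Rightarrow> (real^'n) set" where
  "achievable_voltages R X a Z = (\<lambda>(p, q). voltage R X a p q) ` injections Z"

(* A minimizer exists and is unique when S is nonempty, compact and convex and c is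
   continuous and strongly convex on S; only then is the definite description meaningful. *)
definition best_response ::
    "(real \<times> real \<Rightarrow> real) \<Rightarrow> (real \<times> real) set \<Rightarrow> real \<Rightarrow> real \<Rightarrow> real \<times> real" where
  "best_response c S \<alpha> \<beta> =
     (THE z. is_arg_min (\<lambda>(x, y). c (x, y) - \<alpha> * x - \<beta> * y) (\<lambda>z. z \<in> S) z)"

definition P3_objective ::
    "('n::finite \<Rightarrow> real \<times> real \<Rightarrow> real) \<Rightarrow> (real^'n \<Rightarrow> real) \<Rightarrow> real \<Rightarrow>
     (real^'n) \<times> (real^'n) \<times> (real^'n) \<Rightarrow> real" where
  "P3_objective C D \<gamma> = (\<lambda>(p, q, v). (\<Sum>i\<in>UNIV. C i (p $ i, q $ i)) + \<gamma> * D v)"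

(* The order on real^'n is componentwise. *)
definition P3_feasible ::
    "('n::finite \<Rightarrow> (real \<times> real) set) \<Rightarrow> real^'n^'n \<Rightarrow> real^'n^'n \<Rightarrow> real^'n \<Rightarrow> real^'n \<Rightarrow> real^'n \<Rightarrow>
     ((real^'n) \<times> (real^'n) \<times> (real^'n)) set" where
  "P3_feasible Z R X a v_lo v_hi =
     {(p, q, v). v = voltage R X a p q \<and> v_lo \<le> v \<and> v \<le> v_hi \<and>
        (\<forall>i. (p $ i, q $ i) \<in> Z i)}"

definition P2_objective ::
    "('n::finite \<Rightarrow> real \<times> real \<Rightarrow> real) \<Rightarrow> (real^'n \<Rightarrow> real) \<Rightarrow> real \<Rightarrow>
     (real^'n) \<times> (real^'n) \<times> (real^'n) \<times> (real^'n) \<times> (real^'n) \<Rightarrow> real" where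
  "P2_objective C D \<gamma> = (\<lambda>(p, q, v, \<alpha>, \<beta>). (\<Sum>i\<in>UNIV. C i (p $ i, q $ i)) + \<gamma> * D v)"

definition P2_feasible ::
    "('n::finite \<Rightarrow> real \<times> real \<Rightarrow> real) \<Rightarrow> ('n \<Rightarrow> (real \<times> real) set) \<Rightarrow>
     real^'n^'n \<Rightarrow> real^'n^'n \<Rightarrow> real^'n \<Rightarrow> real^'n \<Rightarrow> real^'n \<Rightarrow>
     ((real^'n) \<times> (real^'n) \<times> (real^'n) \<times> (real^'n) \<times> (real^'n)) set" where
  "P2_feasible C Z R X a v_lo v_hi =
     {(p, q, v, \<alpha>, \<beta>). v = voltage R X a p q \<and> v_lo \<le> v \<and> v \<le> v_hi \<and>
        (\<forall>i. (p $ i, q $ i) = best_response (C i) (Z i) (\<alpha> $ i) (\<beta> $ i))}"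

definition lagrangian ::
    "('n::finite \<Rightarrow> real \<times> real \<Rightarrow> real) \<Rightarrow> (real^'n \<Rightarrow> real) \<Rightarrow> real \<Rightarrow>
     real^'n^'n \<Rightarrow> real^'n^'n \<Rightarrow> real^'n \<Rightarrow> real^'n \<Rightarrow> real^'n \<Rightarrow>
     real^'n \<Rightarrow> real^'n \<Rightarrow> real^'n \<Rightarrow> real^'n \<Rightarrow> real" where
  "lagrangian C D \<gamma> R X a v_lo v_hi p q \<mu>_lo \<mu>_hi =
     (\<Sum>i\<in>UNIV. C i (p $ i, q $ i)) + \<gamma> * D (R *v p + X *v q + a)
     + \<mu>_lo \<bullet> (v_lo - R *v p - X *v q - a) + \<mu>_hi \<bullet> (R *v p + X *v q + a - v_hi)"

definition saddle_point ::
    "('n::finite \<Rightarrow> real \<times> real \<Rightarrow> real) \<Rightarrow> (real^'n \<Rightarrow> real) \<Rightarrow> real \<Rightarrow>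
     ('n \<Rightarrow> (real \<times> real) set) \<Rightarrow>
     real^'n^'n \<Rightarrow> real^'n^'n \<Rightarrow> real^'n \<Rightarrow> real^'n \<Rightarrow> real^'n \<Rightarrow>
     real^'n \<Rightarrow> real^'n \<Rightarrow> real^'n \<Rightarrow> real^'n \<Rightarrow> bool" where
  "saddle_point C D \<gamma> Z R X a v_lo v_hi p q \<mu>_lo \<mu>_hi \<longleftrightarrow>
     (p, q) \<in> injections Z \<and> 0 \<le> \<mu>_lo \<and> 0 \<le> \<mu>_hi \<and>
     (\<forall>(p', q')\<in>injections Z.
        lagrangian C D \<gamma> R X a v_lo v_hi p q \<mu>_lo \<mu>_hi
          \<le> lagrangian C D \<gamma> R X a v_lo v_hi p' q' \<mu>_lo \<mu>_hi) \<and>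
     (\<forall>\<nu>_lo \<nu>_hi. 0 \<le> \<nu>_lo \<and> 0 \<le> \<nu>_hi \<longrightarrow>
        lagrangian C D \<gamma> R X a v_lo v_hi p q \<nu>_lo \<nu>_hi
          \<le> lagrangian C D \<gamma> R X a v_lo v_hi p q \<mu>_lo \<mu>_hi)"

(* Minimizing f' over F' is a convex problem; it relaxes the problem of minimizing f over F
   along the projection \<pi> (which forgets the additional variables); and it is exact: each
   of its optimal solutions extends to an optimal solution of the original problem. *)
definition exact_convex_relaxation ::
    "('b::real_vector \<Rightarrow> real) \<Rightarrow> 'b set \<Rightarrow> ('a \<Rightarrow> 'b) \<Rightarrow> ('a \<Rightarrow> real) \<Rightarrow> 'a set \<Rightarrow> bool" where
  "exact_convex_relaxation f' F' \<pi> f F \<longleftrightarrow>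
     convex F' \<and> convex_on F' f' \<and>
     (\<forall>y\<in>F. \<pi> y \<in> F' \<and> f' (\<pi> y) = f y) \<and>
     (\<forall>x. is_arg_min f' (\<lambda>x. x \<in> F') x \<longrightarrow>
        (\<exists>y. is_arg_min f (\<lambda>y. y \<in> F) y \<and> \<pi> y = x))"

end

theory Submission
  imports Defs
begin

text \<open>
  The saddle point condition says that \<open>(p, q)\<close> minimizes the Lagrangian over the injections.
  The Lagrangian is the convex separable function \<open>\<Sum>i. C i (p $ i, q $ i)\<close> plus a function that
  is differentiable at \<open>(p, q)\<close>, with derivative \<open>(dp, dq) \<mapsto> - w \<bullet> (R dp + X dq)\<close>. A minimizer of
  a convex function plus a differentiable one still minimizes when the differentiable summand
  is replaced by its linearization at the minimizer (\<open>minimizer_linearized\<close>). Hence \<open>(p, q)\<close>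
  minimizes \<open>(\<Sum>i. C i (p $ i, q $ i)) - \<alpha> \<bullet> p - \<beta> \<bullet> q\<close> with the signals
  \<open>\<alpha> = transpose R w\<close> and \<open>\<beta> = transpose X w\<close>: the signals are the prices at which the
  coupling through the network disappears. What remains separates over the nodes, so each
  \<open>(p $ i, q $ i)\<close> solves the problem of node \<open>i\<close> (\<open>separable_minimizer\<close>), and by strong convexity
  it is the best response (\<open>best_response_eqI\<close>).

  Thus \<open>(p, q, v)\<close> with these signals is feasible for the problem with best responses.
  Conversely, best responses lie in the sets \<open>Z i\<close>, so forgetting the signals maps feasible
  points of that problem to feasible points of the convex one, with the same objective;
  optimality follows. Strong convexity of the \<open>C i\<close> also makes
  the solution of the convex problem unique (\<open>P3_minimizer_unique\<close>), which is why lifting this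
  single solution suffices for exactness of the relaxation.
\<close>

section \<open>Minimizers of convex functions\<close>

text \<open>
  Moving from the minimizer \<open>z\<close> towards \<open>y\<close>, convexity bounds \<open>c\<close> from above by its chord. The
  chord plus \<open>h\<close> is then minimal at the start of the segment, so its derivative there, which is
  \<open>c y - c z + h' (y - z)\<close>, cannot be negative.
\<close>

lemma minimizer_linearized:
  fixes c h :: "'a::real_normed_vector \<Rightarrow> real"
  assumes c: "convex_on S c" and z: "z \<in> S" and y: "y \<in> S"
    and h: "(h has_derivative h') (at z)"
    and min: "\<And>u. u \<in> S \<Longrightarrow> c z + h z \<le> c u + h u"
  shows "c z \<le> c y + h' (y - z)"
proof (rule ccontr)
  define \<phi> where "\<phi> t = (1 - t) * c z + t * c y + h (z + t *\<^sub>R (y - z))" for t :: real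
  assume "\<not> ?thesis"
  then have neg: "c y - c z + h' (y - z) < 0" by simp
  have "((\<lambda>t. z + t *\<^sub>R (y - z)) has_derivative (\<lambda>t. t *\<^sub>R (y - z))) (at (0::real))"
    by (auto intro!: derivative_eq_intros)
  from has_derivative_compose[OF this, of h h'] h
  have "((\<lambda>t. h (z + t *\<^sub>R (y - z))) has_derivative (\<lambda>t. h' (t *\<^sub>R (y - z)))) (at (0::real))"
    by simp
  moreover have "h' (t *\<^sub>R (y - z)) = h' (y - z) * t" for t
    using linear_cmul[OF has_derivative_linear[OF h]] by simp
  ultimately have "((\<lambda>t. h (z + t *\<^sub>R (y - z))) has_real_derivative h' (y - z)) (at 0)"
    by (simp add: has_field_derivative_def)
  then have "(\<phi> has_real_derivative c y - c z + h' (y - z)) (at 0)"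
    unfolding \<phi>_def by (auto intro!: derivative_eq_intros)
  from DERIV_neg_dec_right[OF this neg]
  obtain d where d: "d > 0" "\<And>t. 0 < t \<Longrightarrow> t < d \<Longrightarrow> \<phi> t < \<phi> 0" by auto
  \<comment> \<open>a step short enough for the descent, and at most 1 so as to remain on the segment\<close>
  define t where "t = min (d / 2) 1"
  have t: "0 < t" "t < d" "t \<le> 1" using d(1) by (auto simp: t_def)
  have eq: "z + t *\<^sub>R (y - z) = (1 - t) *\<^sub>R z + t *\<^sub>R y" by (simp add: algebra_simps)
  have "(1 - t) *\<^sub>R z + t *\<^sub>R y \<in> S"
    using convex_on_imp_convex[OF c] z y t by (auto intro: convexD_alt)
  from min[OF this] have "\<phi> 0 \<le> c ((1 - t) *\<^sub>R z + t *\<^sub>R y) + h ((1 - t) *\<^sub>R z + t *\<^sub>R y)"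
    by (simp add: \<phi>_def)
  also have "\<dots> \<le> \<phi> t"
    using convex_onD[OF c, of t z y] t z y by (simp add: \<phi>_def eq)
  finally show False using d(2)[OF t(1,2)] by simp
qed

lemma strongly_convex_on_imp_convex_on:
  assumes "strongly_convex_on S f"
  shows "convex_on S f"
proof -
  from assms obtain m where S: "convex S" and m: "m > 0"
    and f: "\<And>x y t. x \<in> S \<Longrightarrow> y \<in> S \<Longrightarrow> t \<in> {0..1} \<Longrightarrow> f ((1 - t) *\<^sub>R x + t *\<^sub>R y)
          \<le> (1 - t) * f x + t * f y - m / 2 * t * (1 - t) * (norm (x - y))\<^sup>2"
    unfolding strongly_convex_on_def by blast
  show ?thesis
  proof (rule convex_onI[OF _ S])
    fix t x y assume t: "0 < (t::real)" "t < 1" and "x \<in> S" "y \<in> S"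
    moreover have "0 \<le> m / 2 * t * (1 - t) * (norm (x - y))\<^sup>2" using m t by simp
    ultimately show "f ((1 - t) *\<^sub>R x + t *\<^sub>R y) \<le> (1 - t) * f x + t * f y"
      using f[of x y t] by force
  qed
qed

lemma strongly_convex_on_midpoint_less:
  assumes "strongly_convex_on S f" and xy: "x \<in> S" "y \<in> S" "x \<noteq> y"
  shows "f (midpoint x y) < (f x + f y) / 2"
proof -
  from assms(1) obtain m where m: "m > 0"
    and f: "\<And>x y t. x \<in> S \<Longrightarrow> y \<in> S \<Longrightarrow> t \<in> {0..1} \<Longrightarrow> f ((1 - t) *\<^sub>R x + t *\<^sub>R y)
          \<le> (1 - t) * f x + t * f y - m / 2 * t * (1 - t) * (norm (x - y))\<^sup>2"
    unfolding strongly_convex_on_def by blast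
  have "0 < m / 2 * (1/2) * (1 - 1/2) * (norm (x - y))\<^sup>2" using m xy by simp
  moreover have "(1 - 1/2) *\<^sub>R x + (1/2) *\<^sub>R y = midpoint x y"
    by (simp add: midpoint_def scaleR_right_distrib)
  ultimately show ?thesis using f[of x y "1/2"] xy by (simp add: field_simps)
qed

lemma convex_on_midpoint_le:
  assumes "convex_on S f" "x \<in> S" "y \<in> S"
  shows "f (midpoint x y) \<le> (f x + f y) / 2"
proof -
  have "(1 - 1/2) *\<^sub>R x + (1/2) *\<^sub>R y = midpoint x y"
    by (simp add: midpoint_def scaleR_right_distrib)
  then show ?thesis using convex_onD[OF assms(1), of "1/2" x y] assms by (simp add: field_simps)
qed

lemma convex_midpoint_mem: "convex S \<Longrightarrow> x \<in> S \<Longrightarrow> y \<in> S \<Longrightarrow> midpoint x y \<in> S"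
  by (meson midpoint_in_closed_segment closed_segment_subset subsetD)

lemma is_arg_min_unique:
  fixes f :: "'a::real_vector \<Rightarrow> real"
  assumes x: "is_arg_min f (\<lambda>x. x \<in> S) x" and y: "is_arg_min f (\<lambda>x. x \<in> S) y"
    and "convex S"
    and strict: "\<And>x y. x \<in> S \<Longrightarrow> y \<in> S \<Longrightarrow> x \<noteq> y \<Longrightarrow> f (midpoint x y) < (f x + f y) / 2"
  shows "x = y"
proof (rule ccontr)
  assume "x \<noteq> y"
  have S: "x \<in> S" "y \<in> S" using x y by (auto simp: is_arg_min_def)
  then have m: "midpoint x y \<in> S" by (rule convex_midpoint_mem[OF \<open>convex S\<close>])
  have "f x \<le> f (midpoint x y)" "f y \<le> f (midpoint x y)"
    using x y m by (auto simp: is_arg_min_linorder)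
  with strict[OF S \<open>x \<noteq> y\<close>] show False by simp
qed

section \<open>Best responses\<close>

lemma best_response_eqI:
  assumes c: "strongly_convex_on S c"
    and z: "is_arg_min (\<lambda>(x, y). c (x, y) - \<alpha> * x - \<beta> * y) (\<lambda>z. z \<in> S) z"
  shows "best_response c S \<alpha> \<beta> = z"
  unfolding best_response_def
proof (rule the_equality, rule z)
  fix z' assume z': "is_arg_min (\<lambda>(x, y). c (x, y) - \<alpha> * x - \<beta> * y) (\<lambda>z. z \<in> S) z'"
  show "z' = z"
  proof (rule is_arg_min_unique[OF z' z])
    show "convex S" using c by (simp add: strongly_convex_on_def)
    fix x y assume xy: "x \<in> S" "y \<in> S" "x \<noteq> y"
    show "(case midpoint x y of (x, y) \<Rightarrow> c (x, y) - \<alpha> * x - \<beta> * y)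
      < ((case x of (x, y) \<Rightarrow> c (x, y) - \<alpha> * x - \<beta> * y)
         + (case y of (x, y) \<Rightarrow> c (x, y) - \<alpha> * x - \<beta> * y)) / 2"
      using strongly_convex_on_midpoint_less[OF c xy]
      by (auto simp: midpoint_def field_simps split: prod.splits)
  qed
qed

text \<open>
  The definite description denotes a minimizer only if one exists, which is what compactness and
  continuity provide.
\<close>

lemma best_response_mem:
  assumes c: "strongly_convex_on S c" and cont: "continuous_on S c"
    and S: "compact S" "S \<noteq> {}"
  shows "best_response c S \<alpha> \<beta> \<in> S"
proof -
  have "continuous_on S (\<lambda>(x, y). c (x, y) - \<alpha> * x - \<beta> * y)"
    using cont unfolding case_prod_unfold by (auto intro!: continuous_intros)
  from continuous_attains_inf[OF S this]
  obtain z where "is_arg_min (\<lambda>(x, y). c (x, y) - \<alpha> * x - \<beta> * y) (\<lambda>z. z \<in> S) z"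
    unfolding is_arg_min_linorder by blast
  with best_response_eqI[OF c this] show ?thesis by (simp add: is_arg_min_def)
qed

lemma cont_diff_on_imp_continuous_on:
  assumes "cont_diff_on S f" shows "continuous_on S f"
proof (rule continuous_at_imp_continuous_on, rule ballI)
  fix x assume "x \<in> S"
  then have "(f has_derivative (\<lambda>h. h \<bullet> grad f x)) (at x)"
    using assms by (simp add: cont_diff_on_def gderiv_def)
  then show "isCont f x" by (rule has_derivative_continuous)
qed

section \<open>Separable costs over the injections\<close>

lemma convex_injections:
  assumes "\<And>i. convex (Z i)"
  shows "convex (injections Z)"
proof (rule convexI)
  fix x y :: "(real^'a) \<times> (real^'a)" and u t :: real
  assume xy: "x \<in> injections Z" "y \<in> injections Z" and ut: "0 \<le> u" "0 \<le> t" "u + t = 1"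
  have "u *\<^sub>R (fst x $ i, snd x $ i) + t *\<^sub>R (fst y $ i, snd y $ i) \<in> Z i" for i
    using xy by (intro convexD[OF assms] ut) (auto simp: injections_def)
  then show "u *\<^sub>R x + t *\<^sub>R y \<in> injections Z"
    by (cases x; cases y) (simp add: injections_def)
qed

lemma convex_on_separable_cost:
  assumes "\<And>i. convex_on (Z i) (C i)"
  shows "convex_on (injections Z) (\<lambda>(p, q). \<Sum>i\<in>UNIV. C i (p $ i, q $ i))"
proof (rule convex_onI)
  show "convex (injections Z)"
    using assms by (intro convex_injections) (rule convex_on_imp_convex)
  fix t :: real and x y :: "(real^'a) \<times> (real^'a)"
  assume t: "0 < t" "t < 1" and xy: "x \<in> injections Z" "y \<in> injections Z"
  obtain p q p' q' where [simp]: "x = (p, q)" "y = (p', q')" by (cases x; cases y)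
  have "C i ((1 - t) *\<^sub>R (p $ i, q $ i) + t *\<^sub>R (p' $ i, q' $ i))
      \<le> (1 - t) * C i (p $ i, q $ i) + t * C i (p' $ i, q' $ i)" for i
    using t xy by (intro convex_onD[OF assms]) (auto simp: injections_def)
  then have "(\<Sum>i\<in>UNIV. C i ((1 - t) * p $ i + t * p' $ i, (1 - t) * q $ i + t * q' $ i))
      \<le> (\<Sum>i\<in>UNIV. (1 - t) * C i (p $ i, q $ i) + t * C i (p' $ i, q' $ i))"
    by (intro sum_mono) simp
  then show "(case (1 - t) *\<^sub>R x + t *\<^sub>R y of (p, q) \<Rightarrow> \<Sum>i\<in>UNIV. C i (p $ i, q $ i))
      \<le> (1 - t) * (case x of (p, q) \<Rightarrow> \<Sum>i\<in>UNIV. C i (p $ i, q $ i))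
        + t * (case y of (p, q) \<Rightarrow> \<Sum>i\<in>UNIV. C i (p $ i, q $ i))"
    by (simp add: sum.distrib sum_distrib_left)
qed

lemma separable_cost_midpoint_less:
  assumes C: "\<And>i. strongly_convex_on (Z i) (C i)"
    and pq: "(p, q) \<in> injections Z" and pq': "(p', q') \<in> injections Z"
    and neq: "(p, q) \<noteq> (p', q')"
  shows "(\<Sum>i\<in>UNIV. C i (midpoint p p' $ i, midpoint q q' $ i))
    < ((\<Sum>i\<in>UNIV. C i (p $ i, q $ i)) + (\<Sum>i\<in>UNIV. C i (p' $ i, q' $ i))) / 2"
proof -
  let ?z = "\<lambda>i. (p $ i, q $ i)" and ?z' = "\<lambda>i. (p' $ i, q' $ i)"
  have Z: "?z i \<in> Z i" "?z' i \<in> Z i" for i using pq pq' by (auto simp: injections_def)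
  have mid: "(midpoint p p' $ i, midpoint q q' $ i) = midpoint (?z i) (?z' i)" for i
    by (simp add: midpoint_def)
  from neq obtain j where j: "?z j \<noteq> ?z' j" by (auto simp: vec_eq_iff)
  have "(\<Sum>i\<in>UNIV. C i (midpoint (?z i) (?z' i))) < (\<Sum>i\<in>UNIV. (C i (?z i) + C i (?z' i)) / 2)"
  proof (rule sum_strict_mono_ex1)
    show "\<forall>i\<in>UNIV. C i (midpoint (?z i) (?z' i)) \<le> (C i (?z i) + C i (?z' i)) / 2"
      using convex_on_midpoint_le[OF strongly_convex_on_imp_convex_on[OF C]] Z by blast
    show "\<exists>i\<in>UNIV. C i (midpoint (?z i) (?z' i)) < (C i (?z i) + C i (?z' i)) / 2"
      using strongly_convex_on_midpoint_less[OF C] Z j by blast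
  qed simp
  then show ?thesis by (simp add: mid sum.distrib flip: sum_divide_distrib)
qed

text \<open>
  The set of injections is a product over the nodes, so node \<open>i\<close> can deviate alone and all other
  terms cancel.
\<close>

lemma separable_minimizer:
  fixes p q :: "real^'n::finite"
  assumes pq: "(p, q) \<in> injections Z"
    and min: "\<And>p' q'. (p', q') \<in> injections Z \<Longrightarrow>
      (\<Sum>i\<in>UNIV. f i (p $ i, q $ i)) \<le> (\<Sum>i\<in>UNIV. f i (p' $ i, q' $ i) :: real)"
    and z: "z \<in> Z i"
  shows "f i (p $ i, q $ i) \<le> f i z"
proof -
  define p' q' where "p' = (\<chi> j. if j = i then fst z else p $ j)"
    and "q' = (\<chi> j. if j = i then snd z else q $ j)"
  have "(p', q') \<in> injections Z" using pq z by (auto simp: injections_def p'_def q'_def)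
  from min[OF this] have "(\<Sum>j\<in>UNIV. f j (p $ j, q $ j)) \<le> (\<Sum>j\<in>UNIV. f j (p' $ j, q' $ j))" .
  moreover have "(\<Sum>j\<in>UNIV - {i}. f j (p' $ j, q' $ j)) = (\<Sum>j\<in>UNIV - {i}. f j (p $ j, q $ j))"
    by (intro sum.cong) (auto simp: p'_def q'_def)
  ultimately show ?thesis by (simp add: sum.remove[of UNIV i] p'_def q'_def)
qed

section \<open>The convex problem\<close>

lemma voltage_convex_combination:
  assumes "u + t = 1"
  shows "voltage R X a (u *\<^sub>R p + t *\<^sub>R p') (u *\<^sub>R q + t *\<^sub>R q')
    = u *\<^sub>R voltage R X a p q + t *\<^sub>R voltage R X a p' q'"
proof -
  have "a = u *\<^sub>R a + t *\<^sub>R a" using assms by (metis scaleR_left_distrib scaleR_one)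
  then show ?thesis
    by (simp add: voltage_def matrix_vector_right_distrib matrix_vector_mult_scaleR
        scaleR_right_distrib add_ac)
qed

lemma P3_feasible_iff:
  "(p, q, v) \<in> P3_feasible Z R X a v_lo v_hi \<longleftrightarrow>
    (p, q) \<in> injections Z \<and> v = voltage R X a p q \<and> v_lo \<le> v \<and> v \<le> v_hi"
  by (auto simp: P3_feasible_def injections_def)

lemma P3_feasible_achievable:
  "(p, q, v) \<in> P3_feasible Z R X a v_lo v_hi \<Longrightarrow> v \<in> achievable_voltages R X a Z"
  by (force simp: P3_feasible_iff achievable_voltages_def)

lemma convex_P3_feasible:
  assumes "\<And>i. convex (Z i)"
  shows "convex (P3_feasible Z R X a v_lo v_hi)"
proof (rule convexI)
  fix x y :: "(real^'a) \<times> (real^'a) \<times> (real^'a)" and u t :: real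
  assume xy: "x \<in> P3_feasible Z R X a v_lo v_hi" "y \<in> P3_feasible Z R X a v_lo v_hi"
    and ut: "0 \<le> u" "0 \<le> t" "u + t = 1"
  obtain p q v p' q' v' where [simp]: "x = (p, q, v)" "y = (p', q', v')"
    by (metis prod_cases3)
  have "u *\<^sub>R (p, q) + t *\<^sub>R (p', q') \<in> injections Z"
    using xy by (intro convexD[OF convex_injections[OF assms]] ut) (auto simp: P3_feasible_iff)
  moreover have "u *\<^sub>R v + t *\<^sub>R v' \<in> {v_lo..v_hi}"
    using xy by (intro convexD[OF convex_box(1)[of v_lo v_hi, folded interval_cbox_cart]] ut)
      (auto simp: P3_feasible_iff)
  ultimately show "u *\<^sub>R x + t *\<^sub>R y \<in> P3_feasible Z R X a v_lo v_hi"
    using xy ut by (auto simp: P3_feasible_iff voltage_convex_combination)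
qed

lemma convex_on_P3_objective:
  assumes C: "\<And>i. convex_on (Z i) (C i)"
    and D: "convex_on (achievable_voltages R X a Z) D" and \<gamma>: "\<gamma> \<ge> 0"
  shows "convex_on (P3_feasible Z R X a v_lo v_hi) (P3_objective C D \<gamma>)"
proof (rule convex_onI)
  show "convex (P3_feasible Z R X a v_lo v_hi)"
    using C by (intro convex_P3_feasible) (rule convex_on_imp_convex)
  fix t :: real and x y :: "(real^'a) \<times> (real^'a) \<times> (real^'a)"
  assume t: "0 < t" "t < 1"
    and xy: "x \<in> P3_feasible Z R X a v_lo v_hi" "y \<in> P3_feasible Z R X a v_lo v_hi"
  obtain p q v p' q' v' where [simp]: "x = (p, q, v)" "y = (p', q', v')"
    by (metis prod_cases3)
  have "D ((1 - t) *\<^sub>R v + t *\<^sub>R v') \<le> (1 - t) * D v + t * D v'"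
    using t xy P3_feasible_achievable by (intro convex_onD[OF D]) auto
  from mult_left_mono[OF this \<gamma>]
  have "\<gamma> * D ((1 - t) *\<^sub>R v + t *\<^sub>R v') \<le> (1 - t) * (\<gamma> * D v) + t * (\<gamma> * D v')"
    by (simp add: algebra_simps)
  moreover have "(p, q) \<in> injections Z" "(p', q') \<in> injections Z"
    using xy by (auto simp: P3_feasible_iff)
  note convex_onD[OF convex_on_separable_cost[where Z=Z and C=C, OF C] _ _ this, of t]
  ultimately show "P3_objective C D \<gamma> ((1 - t) *\<^sub>R x + t *\<^sub>R y)
      \<le> (1 - t) * P3_objective C D \<gamma> x + t * P3_objective C D \<gamma> y"
    using t by (simp add: P3_objective_def distrib_left)
qed

text \<open>
  Although \<open>D\<close> is merely convex, the objective is strictly convex along the feasible set: two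
  feasible points that differ must already differ in the injections, which determine \<open>v\<close>.
\<close>

lemma P3_minimizer_unique:
  assumes C: "\<And>i. strongly_convex_on (Z i) (C i)"
    and D: "convex_on (achievable_voltages R X a Z) D" and \<gamma>: "\<gamma> \<ge> 0"
    and x: "is_arg_min (P3_objective C D \<gamma>) (\<lambda>x. x \<in> P3_feasible Z R X a v_lo v_hi) x"
    and y: "is_arg_min (P3_objective C D \<gamma>) (\<lambda>x. x \<in> P3_feasible Z R X a v_lo v_hi) y"
  shows "x = y"
proof (rule is_arg_min_unique[OF x y])
  show "convex (P3_feasible Z R X a v_lo v_hi)"
    using C by (intro convex_P3_feasible) (simp add: strongly_convex_on_def)
  fix x y :: "(real^'a) \<times> (real^'a) \<times> (real^'a)"
  assume xy: "x \<in> P3_feasible Z R X a v_lo v_hi" "y \<in> P3_feasible Z R X a v_lo v_hi" "x \<noteq> y"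
  obtain p q v p' q' v' where [simp]: "x = (p, q, v)" "y = (p', q', v')"
    by (metis prod_cases3)
  have "(p, q) \<in> injections Z" "(p', q') \<in> injections Z" "(p, q) \<noteq> (p', q')"
    using xy by (auto simp: P3_feasible_iff)
  note separable_cost_midpoint_less[where Z=Z and C=C, OF C this]
  moreover have "D (midpoint v v') \<le> (D v + D v') / 2"
    using xy P3_feasible_achievable by (intro convex_on_midpoint_le[OF D]) auto
  from mult_left_mono[OF this \<gamma>]
  have "\<gamma> * D (midpoint v v') \<le> (\<gamma> * D v + \<gamma> * D v') / 2"
    by (simp add: algebra_simps)
  moreover have "midpoint x y = (midpoint p p', midpoint q q', midpoint v v')"
    by (simp add: midpoint_def)
  ultimately show "P3_objective C D \<gamma> (midpoint x y)
      < (P3_objective C D \<gamma> x + P3_objective C D \<gamma> y) / 2"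
    by (simp add: P3_objective_def add_divide_distrib)
qed

section \<open>Prices from the saddle point\<close>

text \<open>
  Linearizing every term of the Lagrangian other than the costs \<open>C i\<close> turns the network coupling
  into the linear price term below. The transposes arise from moving \<open>R\<close> and \<open>X\<close> to the other
  side of the inner product.
\<close>

lemma saddle_point_minimizes_priced_cost:
  assumes C: "\<And>i. convex_on (Z i) (C i)"
    and D: "cont_diff_on (achievable_voltages R X a Z) D"
    and saddle: "saddle_point C D \<gamma> Z R X a v_lo v_hi p q \<mu>_lo \<mu>_hi"
    and w: "w = \<mu>_lo - \<mu>_hi - \<gamma> *\<^sub>R grad D (voltage R X a p q)"
    and pq': "(p', q') \<in> injections Z"
  shows "(\<Sum>i\<in>UNIV. C i (p $ i, q $ i)) - (transpose R *v w) \<bullet> p - (transpose X *v w) \<bullet> q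
    \<le> (\<Sum>i\<in>UNIV. C i (p' $ i, q' $ i)) - (transpose R *v w) \<bullet> p' - (transpose X *v w) \<bullet> q'"
proof -
  let ?v = "voltage R X a p q"
  define c where "c = (\<lambda>(p, q). \<Sum>i\<in>UNIV. C i (p $ i, q $ i))"
  define V where "V x = R *v fst x + X *v snd x + a" for x
  define h where "h x = \<gamma> * D (V x) + \<mu>_lo \<bullet> (v_lo - V x) + \<mu>_hi \<bullet> (V x - v_hi)" for x
  have L: "lagrangian C D \<gamma> R X a v_lo v_hi r s \<mu>_lo \<mu>_hi = c (r, s) + h (r, s)" for r s
    by (simp add: lagrangian_def c_def h_def V_def algebra_simps)
  have pq: "(p, q) \<in> injections Z" using saddle by (simp add: saddle_point_def)
  have Vpq: "V (p, q) = ?v" by (simp add: V_def voltage_def)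
  have "?v \<in> achievable_voltages R X a Z" using pq by (force simp: achievable_voltages_def)
  then have "(D has_derivative (\<lambda>u. u \<bullet> grad D ?v)) (at (V (p, q)))"
    using D by (simp add: cont_diff_on_def gderiv_def Vpq)
  moreover have V: "(V has_derivative (\<lambda>u. R *v fst u + X *v snd u)) (at (p, q))"
    unfolding V_def
    by (auto intro!: derivative_eq_intros
        bounded_linear.has_derivative[OF matrix_vector_mul_bounded_linear])
  ultimately have "((\<lambda>x. D (V x)) has_derivative
      (\<lambda>u. (R *v fst u + X *v snd u) \<bullet> grad D ?v)) (at (p, q))"
    by (rule has_derivative_compose[rotated])
  then have "(h has_derivative (\<lambda>u. - (w \<bullet> (R *v fst u + X *v snd u)))) (at (p, q))"
    unfolding h_def using V
    by (auto intro!: derivative_eq_intros simp: w inner_commute algebra_simps)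
  moreover have "convex_on (injections Z) c"
    unfolding c_def by (rule convex_on_separable_cost[where Z=Z and C=C, OF C])
  moreover have "c (p, q) + h (p, q) \<le> c u + h u" if "u \<in> injections Z" for u
    using saddle that by (cases u) (auto simp: saddle_point_def L)
  ultimately have "c (p, q) \<le> c (p', q') - w \<bullet> (R *v (p' - p) + X *v (q' - q))"
    using minimizer_linearized[OF _ pq pq', of c h] by fastforce
  then show ?thesis
    by (simp add: c_def transpose_matrix_vector dot_lmul_matrix algebra_simps)
qed

text \<open>
  The inner products with the signals are sums over the nodes, so the priced cost is separable and
  its minimizer over the product set is a minimizer at each node.
\<close>

lemma saddle_point_best_response:
  assumes C: "\<And>i. strongly_convex_on (Z i) (C i)"
    and D: "cont_diff_on (achievable_voltages R X a Z) D"
    and saddle: "saddle_point C D \<gamma> Z R X a v_lo v_hi p q \<mu>_lo \<mu>_hi"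
    and w: "w = \<mu>_lo - \<mu>_hi - \<gamma> *\<^sub>R grad D (voltage R X a p q)"
  shows "best_response (C i) (Z i) ((transpose R *v w) $ i) ((transpose X *v w) $ i) = (p $ i, q $ i)"
proof (rule best_response_eqI[OF C])
  let ?\<alpha> = "transpose R *v w" and ?\<beta> = "transpose X *v w"
  let ?f = "\<lambda>i (x, y). C i (x, y) - ?\<alpha> $ i * x - ?\<beta> $ i * y"
  have sum: "(\<Sum>i\<in>UNIV. ?f i (r $ i, s $ i))
      = (\<Sum>i\<in>UNIV. C i (r $ i, s $ i)) - ?\<alpha> \<bullet> r - ?\<beta> \<bullet> s" for r s
    by (simp add: inner_vec_def sum_subtractf)
  have pq: "(p, q) \<in> injections Z" using saddle by (simp add: saddle_point_def)
  have "?f i (p $ i, q $ i) \<le> ?f i z" if "z \<in> Z i" for z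
  proof (rule separable_minimizer[where Z=Z and f="?f", OF pq _ that])
    fix p' q' assume "(p', q') \<in> injections Z"
    then show "(\<Sum>i\<in>UNIV. ?f i (p $ i, q $ i)) \<le> (\<Sum>i\<in>UNIV. ?f i (p' $ i, q' $ i))"
      unfolding sum
      by (rule saddle_point_minimizes_priced_cost[OF strongly_convex_on_imp_convex_on[OF C] D saddle w])
  qed
  then show "is_arg_min (?f i) (\<lambda>z. z \<in> Z i) (p $ i, q $ i)"
    using pq by (auto simp: is_arg_min_linorder injections_def)
qed

section \<open>The relaxation\<close>

lemma P2_feasible_imp_P3_feasible:
  assumes "\<And>i. strongly_convex_on (Z i) (C i)" and "\<And>i. cont_diff_on (Z i) (C i)"
    and "\<And>i. compact (Z i)" and "\<And>i. Z i \<noteq> {}"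
    and "(p, q, v, \<alpha>, \<beta>) \<in> P2_feasible C Z R X a v_lo v_hi"
  shows "(p, q, v) \<in> P3_feasible Z R X a v_lo v_hi"
  using assms best_response_mem[OF assms(1) cont_diff_on_imp_continuous_on[OF assms(2)]]
  by (auto simp: P2_feasible_def P3_feasible_def)


theorem theorem2:
  fixes C :: "'n::finite \<Rightarrow> real \<times> real \<Rightarrow> real"
    and D :: "real^'n \<Rightarrow> real"
    and \<gamma> :: real
    and Z :: "'n \<Rightarrow> (real \<times> real) set"
    and R X :: "real^'n^'n"
    and a v_lo v_hi :: "real^'n"
    and p q v \<mu>_lo \<mu>_hi w :: "real^'n"
  assumes R_pos: "\<And>i j. R $ i $ j > 0"
    and X_pos: "\<And>i j. X $ i $ j > 0"
    and gamma_nonneg: "\<gamma> \<ge> 0"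
    and Z_convex: "\<And>i. convex (Z i)"
    and Z_compact: "\<And>i. compact (Z i)"
    and C_diff: "\<And>i. cont_diff_on (Z i) (C i)"
    and C_strongly_convex: "\<And>i. strongly_convex_on (Z i) (C i)"
    and C_bounded: "\<And>i. bounded (grad (C i) ` Z i)"
    and D_diff: "cont_diff_on (achievable_voltages R X a Z) D"
    and D_convex: "convex_on (achievable_voltages R X a Z) D"
    and D_bounded: "bounded (grad D ` achievable_voltages R X a Z)"
    and slater: "\<exists>(p', q')\<in>injections Z.
        v_lo \<le> R *v p' + X *v q' + a \<and> R *v p' + X *v q' + a \<le> v_hi"
    and primal: "is_arg_min (P3_objective C D \<gamma>)
        (\<lambda>x. x \<in> P3_feasible Z R X a v_lo v_hi) (p, q, v)"
    and dual: "saddle_point C D \<gamma> Z R X a v_lo v_hi p q \<mu>_lo \<mu>_hi"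
    and w_def: "w = \<mu>_lo - \<mu>_hi - \<gamma> *\<^sub>R grad D v"
  shows "is_arg_min (P2_objective C D \<gamma>) (\<lambda>y. y \<in> P2_feasible C Z R X a v_lo v_hi)
           (p, q, v, transpose R *v w, transpose X *v w)
         \<and> (transpose R = R \<and> transpose X = X \<longrightarrow>
              is_arg_min (P2_objective C D \<gamma>) (\<lambda>y. y \<in> P2_feasible C Z R X a v_lo v_hi)
                (p, q, v, R *v w, X *v w))
         \<and> exact_convex_relaxation
             (P3_objective C D \<gamma>) (P3_feasible Z R X a v_lo v_hi)
             (\<lambda>(p, q, v, \<alpha>, \<beta>). (p, q, v))
             (P2_objective C D \<gamma>) (P2_feasible C Z R X a v_lo v_hi)"
proof -
  let ?F3 = "P3_feasible Z R X a v_lo v_hi" and ?F2 = "P2_feasible C Z R X a v_lo v_hi"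
  let ?f3 = "P3_objective C D \<gamma>" and ?f2 = "P2_objective C D \<gamma>"
  let ?y = "(p, q, v, transpose R *v w, transpose X *v w)"
  have feasible: "(p, q, v) \<in> ?F3" using primal by (simp add: is_arg_min_def)
  have v: "v = voltage R X a p q" using feasible by (simp add: P3_feasible_iff)
  have nonempty: "Z i \<noteq> {}" for i using slater by (auto simp: injections_def)
  have relax: "(r, s, u) \<in> ?F3" if "(r, s, u, \<alpha>, \<beta>) \<in> ?F2" for r s u \<alpha> \<beta>
    using P2_feasible_imp_P3_feasible[OF C_strongly_convex C_diff Z_compact nonempty that] .
  have obj: "?f2 (r, s, u, \<alpha>, \<beta>) = ?f3 (r, s, u)" for r s u \<alpha> \<beta>
    by (simp add: P2_objective_def P3_objective_def)
  have "?y \<in> ?F2"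
    using feasible saddle_point_best_response[OF C_strongly_convex D_diff dual w_def[unfolded v]]
    by (auto simp: P2_feasible_def P3_feasible_iff)
  then have opt: "is_arg_min ?f2 (\<lambda>y. y \<in> ?F2) ?y"
    using primal relax by (force simp: is_arg_min_linorder obj)
  have "exact_convex_relaxation ?f3 ?F3 (\<lambda>(p, q, v, \<alpha>, \<beta>). (p, q, v)) ?f2 ?F2"
    unfolding exact_convex_relaxation_def
  proof (intro conjI allI impI)
    show "convex ?F3" by (rule convex_P3_feasible[OF Z_convex])
    show "convex_on ?F3 ?f3"
      by (rule convex_on_P3_objective[OF strongly_convex_on_imp_convex_on[OF C_strongly_convex]
            D_convex gamma_nonneg])
    show "\<forall>y\<in>?F2. (case y of (p, q, v, \<alpha>, \<beta>) \<Rightarrow> (p, q, v)) \<in> ?F3 \<and>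
        ?f3 (case y of (p, q, v, \<alpha>, \<beta>) \<Rightarrow> (p, q, v)) = ?f2 y"
      using relax by (auto simp: obj)
    fix x assume "is_arg_min ?f3 (\<lambda>x. x \<in> ?F3) x"
    then have "x = (p, q, v)"
      using P3_minimizer_unique[OF C_strongly_convex D_convex gamma_nonneg _ primal] by blast
    then show "\<exists>y. is_arg_min ?f2 (\<lambda>y. y \<in> ?F2) y \<and>
        (case y of (p, q, v, \<alpha>, \<beta>) \<Rightarrow> (p, q, v)) = x"
      using opt by (intro exI[of _ ?y]) simp
  qed
  \<comment> \<open>keeps \<open>transpose R *v w\<close> from becoming \<open>w v* R\<close>, where \<open>transpose R = R\<close> cannot apply\<close>
  with opt show ?thesis by (auto simp del: transpose_matrix_vector)
qed

end
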